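(* Let $n,k\in\mathbb{N}$ with $0<k<n$ and let $\xi\in\mathbb{C}$ be a primitive $n$-th root of unity. Then $\binom{n}{k}_\xi=0$ in $\mathbb{C}$.
   Context: For $n\in\mathbb{N}$ let $[n]_q:=1+q+\cdots+q^{n-1}\in\mathbb{Z}[q]$ (with $[0]_q:=0$), $[n]!_q:=[1]_q[2]_q\cdots[n]_q$ (with $[0]!_q:=1$), and for $0\le k\le n$ let $\binom{n}{k}_q:=\frac{[n]!_q}{[n-k]!_q[k]!_q}\in\mathbb{Q}(q)$, which is in fact a polynomial in $\mathbb{Z}[q]$ (with coefficients in $\mathbb{N}$). For $\xi$ an element of a ring $S$, $\binom{n}{k}_\xi$ denotes the image of $\binom{n}{k}_q$ under the evaluation homomorphism $\mathbb{Z}[q]\to S$, $q\mapsto\xi$. *)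

theory Defs
  imports Complex_Main "HOL-Computational_Algebra.Polynomial_Factorial"
begin

definition q_int :: "nat \<Rightarrow> int poly" where
  "q_int n = (\<Sum>i<n. monom 1 i)"

definition q_fact :: "nat \<Rightarrow> int poly" where
  "q_fact n = (\<Prod>i\<in>{1..n}. q_int i)"

text \<open>
  The field of fractions of \<open>\<int>[q]\<close> serves as \<open>\<rat>(q)\<close>.
  Both binomials below are meaningful only for \<open>k \<le> n\<close>.
\<close>

definition q_binomial_frac :: "nat \<Rightarrow> nat \<Rightarrow> int poly fract" where
  "q_binomial_frac n k = to_fract (q_fact n) / (to_fract (q_fact (n - k)) * to_fract (q_fact k))"

definition q_binomial :: "nat \<Rightarrow> nat \<Rightarrow> int poly" where
  "q_binomial n k = (THE p. to_fract p = q_binomial_frac n k)"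

definition q_binomial_at :: "nat \<Rightarrow> nat \<Rightarrow> 'a::comm_ring_1 \<Rightarrow> 'a" where
  "q_binomial_at n k \<xi> = poly (map_poly of_int (q_binomial n k)) \<xi>"

definition primitive_root_of_unity :: "nat \<Rightarrow> 'a::comm_ring_1 \<Rightarrow> bool" where
  "primitive_root_of_unity n \<xi> \<longleftrightarrow> n > 0 \<and> \<xi> ^ n = 1 \<and> (\<forall>m. 0 < m \<and> m < n \<longrightarrow> \<xi> ^ m \<noteq> 1)"

text \<open>
  The quotient is a polynomial, so the definite description in \<open>q_binomial\<close> denotes.
\<close>

lemma q_fact_0: "q_fact 0 = 1"
  by (simp add: q_fact_def)

lemma q_fact_Suc: "q_fact (Suc n) = q_fact n * q_int (Suc n)"
  by (simp add: q_fact_def)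

lemma q_int_add: "q_int (m + n) = q_int m + monom 1 m * q_int n"
  by (induction n) (simp_all add: q_int_def mult_monom algebra_simps)

lemma q_int_nonzero: "n > 0 \<Longrightarrow> q_int n \<noteq> 0"
proof
  assume "n > 0" "q_int n = 0"
  then have "coeff (q_int n) 0 = 0" by simp
  then show False using \<open>n > 0\<close> by (simp add: q_int_def coeff_sum)
qed

lemma q_fact_nonzero: "q_fact n \<noteq> 0"
  by (auto simp: q_fact_def q_int_nonzero)

lemma q_fact_dvd: "k \<le> n \<Longrightarrow> q_fact (n - k) * q_fact k dvd q_fact n"
proof (induction n arbitrary: k)
  case 0
  then show ?case by (simp add: q_fact_0)
next
  case (Suc m)
  show ?case
  proof (cases "k = 0 \<or> k = Suc m")
    case True
    then show ?thesis by (auto simp: q_fact_0)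
  next
    case False
    then obtain j where k: "k = Suc j" "j < m" using Suc.prems by (cases k) auto
    define d where "d = m - Suc j"
    have d: "m - j = Suc d" "m - Suc j = d" using k by (auto simp: d_def)
    obtain a where a: "q_fact m = q_fact (Suc d) * q_fact j * a"
      using Suc.IH[of j] k d by (auto elim: dvdE)
    obtain b where b: "q_fact m = q_fact d * q_fact (Suc j) * b"
      using Suc.IH[of "Suc j"] k d by (auto elim: dvdE)
    have "Suc j + Suc d = Suc m" using k by (simp add: d_def)
    then have "q_int (Suc m) = q_int (Suc j) + monom 1 (Suc j) * q_int (Suc d)"
      by (metis q_int_add)
    then have "q_fact (Suc m) = q_fact m * q_int (Suc j) + q_fact m * (monom 1 (Suc j) * q_int (Suc d))"
      by (simp only: q_fact_Suc distrib_left)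
    also have "q_fact m * q_int (Suc j) = q_fact (Suc d) * q_fact (Suc j) * a"
      by (simp add: a q_fact_Suc[of j] mult_ac)
    also have "q_fact m * (monom 1 (Suc j) * q_int (Suc d)) =
        q_fact (Suc d) * q_fact (Suc j) * (monom 1 (Suc j) * b)"
      by (simp add: b q_fact_Suc[of d] mult_ac)
    finally show ?thesis using k d by simp
  qed
qed

lemma q_binomial_exists1:
  assumes "k \<le> n"
  shows "\<exists>!p. to_fract p = q_binomial_frac n k"
proof -
  obtain p where p: "q_fact n = q_fact (n - k) * q_fact k * p"
    using q_fact_dvd[OF assms] by (auto elim: dvdE)
  then have "to_fract p = q_binomial_frac n k"
    by (simp add: q_binomial_frac_def q_fact_nonzero)
  then show ?thesis by (metis to_fract_eq_iff)
qed

lemma to_fract_q_binomial: "k \<le> n \<Longrightarrow> to_fract (q_binomial n k) = q_binomial_frac n k"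
  unfolding q_binomial_def by (rule theI') (rule q_binomial_exists1)

end

theory Submission
  imports Defs
begin

text \<open>
  Clear denominators: \<open>[n]! = [n - k]! [k]! \<cdot> binomial(n, k)\<close> holds in \<open>\<int>[q]\<close>, so it can be
  evaluated at \<open>\<xi>\<close>. Since \<open>(\<xi> - 1) [i]\<^sub>\<xi> = \<xi> ^ i - 1\<close>, a primitive \<open>n\<close>-th root of unity with
  \<open>n > 1\<close> is a zero of \<open>[n]\<close> but not of any \<open>[i]\<close> with \<open>0 < i < n\<close>. Hence the left-hand side
  vanishes, whereas for \<open>0 < k < n\<close> both factorials on the right involve only indices below \<open>n\<close>
  and do not vanish. In an integral domain this forces the binomial to vanish.
\<close>

definition eval_int_poly :: "'a::comm_ring_1 \<Rightarrow> int poly \<Rightarrow> 'a" where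
  "eval_int_poly x p = poly (map_poly of_int p) x"

lemma eval_int_poly_1 [simp]: "eval_int_poly x 1 = 1"
  by (simp add: eval_int_poly_def)

lemma eval_int_poly_monom [simp]: "eval_int_poly x (monom c m) = of_int c * x ^ m"
  by (simp add: eval_int_poly_def map_poly_monom poly_monom)

lemma eval_int_poly_sum: "eval_int_poly x (\<Sum>i\<in>A. f i) = (\<Sum>i\<in>A. eval_int_poly x (f i))"
proof -
  have add: "map_poly of_int (p + q) = (map_poly of_int p + map_poly of_int q :: 'a poly)" for p q
    by (rule poly_eqI) (simp add: coeff_map_poly)
  show ?thesis
    by (induction A rule: infinite_finite_induct) (simp_all add: eval_int_poly_def add)
qed

lemma eval_int_poly_mult: "eval_int_poly x (p * q) = eval_int_poly x p * eval_int_poly x q"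
proof -
  have "map_poly of_int (p * q) = (map_poly of_int p * map_poly of_int q :: 'a poly)"
    by (rule poly_eqI) (simp add: coeff_map_poly coeff_mult)
  then show ?thesis by (simp add: eval_int_poly_def)
qed

lemma q_binomial_at_eq_eval: "q_binomial_at n k x = eval_int_poly x (q_binomial n k)"
  by (simp add: q_binomial_at_def eval_int_poly_def)

lemma q_fact_eq_q_binomial_mult:
  assumes "k \<le> n"
  shows "q_fact n = q_fact (n - k) * q_fact k * q_binomial n k"
proof -
  have "to_fract (q_fact n) = to_fract (q_fact (n - k) * q_fact k * q_binomial n k)"
    by (simp add: to_fract_q_binomial[OF assms] q_binomial_frac_def q_fact_nonzero)
  then show ?thesis by (simp only: to_fract_eq_iff)
qed

lemma eval_q_int_geometric: "(x - 1) * eval_int_poly x (q_int i) = x ^ i - 1"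
  by (simp add: q_int_def eval_int_poly_sum power_diff_1_eq)

lemma eval_q_int_eq_0_iff:
  fixes x :: "'a::idom"
  assumes "x \<noteq> 1"
  shows "eval_int_poly x (q_int i) = 0 \<longleftrightarrow> x ^ i = 1"
  using eval_q_int_geometric[of x i] assms by (metis eq_iff_diff_eq_0 mult_eq_0_iff)

text \<open>
  In an integral domain \<open>[m]!\<close> vanishes at \<open>x\<close> exactly when one of its factors \<open>[i]\<close> does,
  that is, when the multiplicative order of \<open>x\<close> is at most \<open>m\<close>. At \<open>x = 1\<close> and \<open>m > 0\<close> this fails in
  characteristic zero, because there \<open>[i]\<close> takes the value \<open>i\<close>.
\<close>

lemma eval_q_fact_eq_0_iff:
  fixes x :: "'a::idom"
  assumes "x \<noteq> 1"
  shows "eval_int_poly x (q_fact m) = 0 \<longleftrightarrow> (\<exists>i. 0 < i \<and> i \<le> m \<and> x ^ i = 1)"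
proof (induction m)
  case 0
  then show ?case by (simp add: q_fact_0)
next
  case (Suc m)
  then show ?case
    by (auto simp: q_fact_Suc eval_int_poly_mult eval_q_int_eq_0_iff[OF assms] le_Suc_eq)
qed

theorem theorem2p18:
  fixes n k :: nat and \<xi> :: complex
  assumes "0 < k" and "k < n"
    and "primitive_root_of_unity n \<xi>"
  shows "q_binomial_at n k \<xi> = 0"
proof -
  have root: "\<xi> ^ n = 1" and primitive: "\<And>i. 0 < i \<Longrightarrow> i < n \<Longrightarrow> \<xi> ^ i \<noteq> 1"
    using assms(3) by (auto simp: primitive_root_of_unity_def)
  have "\<xi> \<noteq> 1"
    using primitive[of 1] assms(1,2) by simp
  note zero_iff = eval_q_fact_eq_0_iff[OF this]
  have "eval_int_poly \<xi> (q_fact n) = 0"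
    using root assms(1,2) by (auto simp: zero_iff intro!: exI[of _ n])
  moreover have "eval_int_poly \<xi> (q_fact k) \<noteq> 0" "eval_int_poly \<xi> (q_fact (n - k)) \<noteq> 0"
    using primitive assms(1,2) by (auto simp: zero_iff)
  moreover have "eval_int_poly \<xi> (q_fact n) = eval_int_poly \<xi> (q_fact (n - k)) *
      eval_int_poly \<xi> (q_fact k) * q_binomial_at n k \<xi>"
    using q_fact_eq_q_binomial_mult[of k n] assms(2)
    by (simp add: eval_int_poly_mult q_binomial_at_eq_eval)
  ultimately show ?thesis by simp
qed

end
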